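(* Let $n\ge 3$ and let $A=(a_{ij})\in\mathbb{C}^{n\times n}$ be irreducible with $A\in H^M_n$. Then $\rho(H_{FGS})<1$ (i.e., the sequence $\{x^{(i)}\}$ generated by the FGS scheme converges to the unique solution of $Ax=b$ for any choice of the initial guess $x^{(0)}$) if and only if $D_A^{-1}A\notin \mathscr{U}^{\psi}_n$ for every $\psi\in\mathbb{R}$.
   Context: The comparison matrix $\mu(A)=(\mu_{ij})$ of $A\in\mathbb{C}^{n\times n}$ has $\mu_{ii}=|a_{ii}|$ and $\mu_{ij}=-|a_{ij}|$ for $i\ne j$. A real matrix with nonpositive off-diagonal entries is an $M$-matrix if it equals $sI-B$ with $B\ge 0$ entrywise and $s\ge\rho(B)$; it is a singular $M$-matrix if $s=\rho(B)$. $H^M_n$ (mixed $H$-matrices) is the set of $A\in\mathbb{C}^{n\times n}$ such that $\mu(A)$ is a singular $M$-matrix and $a_{ii}\ne 0$ for all $i$. Write $A=D_A-L_A-U_A$ with $D_A=\mathrm{diag}(a_{11},\dots,a_{nn})$, $L_A$ strictly lower triangular, $U_A$ strictly upper triangular. The forward Gauss-Seidel (FGS) iteration matrix is $H_{FGS}=(D_A-L_A)^{-1}U_A$, and the FGS scheme for $Ax=b$ is $x^{(i+1)}=H_{FGS}x^{(i)}+(D_A-L_A)^{-1}b$, $i=0,1,2,\dots$. $\rho$ denotes the spectral radius. A matrix $(e^{i\psi_{rs}})\in\mathbb{C}^{n\times n}$ ($\psi_{rs}\in\mathbb{R}$, $i=\sqrt{-1}$) is a $\psi$-ray pattern matrix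 ($\psi\in\mathbb{R}$) if, modulo $2\pi$: (1) $\psi_{rs}+\psi_{sr}\equiv\psi$ for all $r\ne s$; (2) $\psi_{rs}-\psi_{rt}\equiv\psi_{ts}+\pi$ whenever $r<s<t$ or $s<t<r$ or $t<r<s$; (3) $\psi_{rs}-\psi_{rt}\equiv\psi_{ts}-\psi+\pi$ whenever $r<t<s$ or $t<s<r$ or $s<r<t$; (4) $\psi_{rr}=0$ for all $r$. $\mathscr{U}^{\psi}_n$ is the set of $n\times n$ complex matrices $B=(b_{rs})$ for which there exist $\eta\in\mathbb{R}$ and a $\psi$-ray pattern matrix $(e^{i\psi_{rs}})$ with $b_{rs}=e^{i\eta}|b_{rs}|e^{i\psi_{rs}}$ for all $r,s$. *)

theory Defs
  imports
    "Jordan_Normal_Form.Spectral_Radius"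
    "HOL-Combinatorics.Permutations"
    "HOL-Library.Real_Mod"
begin

text \<open>
  Matrices are those of Jordan_Normal_Form, with rows and columns indexed by
  \<open>0, \<dots>, n - 1\<close> instead of \<open>1, \<dots>, n\<close>; only the order of the indices matters.
\<close>

section \<open>Irreducible matrices\<close>

text \<open>
  A matrix is reducible if a simultaneous permutation of its rows and columns brings it to the form
  \<open>(B, C; 0, D)\<close> with square diagonal blocks \<open>B\<close> and \<open>D\<close> of positive size; \<open>k\<close> is the size of \<open>B\<close>.
\<close>

definition reducible_mat :: "nat \<Rightarrow> 'a::zero mat \<Rightarrow> bool" where
  "reducible_mat n A \<longleftrightarrow>
     (\<exists>p k. p permutes {..<n} \<and> 0 < k \<and> k < n \<and>
        (\<forall>i j. k \<le> i \<and> i < n \<and> j < k \<longrightarrow> A $$ (p i, p j) = 0))"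

definition irreducible_mat :: "nat \<Rightarrow> 'a::zero mat \<Rightarrow> bool" where
  "irreducible_mat n A \<longleftrightarrow> A \<in> carrier_mat n n \<and> \<not> reducible_mat n A"

section \<open>Mixed H-matrices\<close>

definition comparison_mat :: "complex mat \<Rightarrow> real mat" where
  "comparison_mat A =
     mat (dim_row A) (dim_col A)
       (\<lambda>(i, j). if i = j then cmod (A $$ (i, i)) else - cmod (A $$ (i, j)))"

text \<open>The order on matrices is entrywise, so \<open>0\<^sub>m n n \<le> B\<close> says that \<open>B\<close> is nonnegative.\<close>

definition singular_M_matrix :: "nat \<Rightarrow> real mat \<Rightarrow> bool" where
  "singular_M_matrix n M \<longleftrightarrow>
     M \<in> carrier_mat n n \<and>
     (\<forall>i<n. \<forall>j<n. i \<noteq> j \<longrightarrow> M $$ (i, j) \<le> 0) \<and>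
     (\<exists>s B. B \<in> carrier_mat n n \<and> 0\<^sub>m n n \<le> B \<and> M = s \<cdot>\<^sub>m 1\<^sub>m n - B \<and>
        s = spectral_radius (map_mat complex_of_real B))"

definition mixed_H_matrices :: "nat \<Rightarrow> complex mat set" where
  "mixed_H_matrices n =
     {A \<in> carrier_mat n n. singular_M_matrix n (comparison_mat A) \<and> (\<forall>i<n. A $$ (i, i) \<noteq> 0)}"

section \<open>The forward Gauss-Seidel method\<close>

text \<open>
  \<open>A = diag_part A - lower_part A - upper_part A\<close>, hence the signs in the last two definitions.
\<close>

definition diag_part :: "'a::zero mat \<Rightarrow> 'a mat" where
  "diag_part A = mat (dim_row A) (dim_col A) (\<lambda>(i, j). if i = j then A $$ (i, j) else 0)"

definition lower_part :: "'a::{zero,uminus} mat \<Rightarrow> 'a mat" where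
  "lower_part A = mat (dim_row A) (dim_col A) (\<lambda>(i, j). if j < i then - A $$ (i, j) else 0)"

definition upper_part :: "'a::{zero,uminus} mat \<Rightarrow> 'a mat" where
  "upper_part A = mat (dim_row A) (dim_col A) (\<lambda>(i, j). if i < j then - A $$ (i, j) else 0)"

text \<open>
  The inverse is unspecified for a singular matrix; below it is only applied to triangular
  matrices whose diagonal is assumed to have no zero.
\<close>

definition inv_mat :: "'a::field mat \<Rightarrow> 'a mat" where
  "inv_mat A = the (mat_inverse A)"

definition FGS_mat :: "complex mat \<Rightarrow> complex mat" where
  "FGS_mat A = inv_mat (diag_part A - lower_part A) * upper_part A"

primrec FGS_seq :: "complex mat \<Rightarrow> complex vec \<Rightarrow> complex vec \<Rightarrow> nat \<Rightarrow> complex vec" where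
  "FGS_seq A b x0 0 = x0"
| "FGS_seq A b x0 (Suc i) =
     FGS_mat A *\<^sub>v FGS_seq A b x0 i + inv_mat (diag_part A - lower_part A) *\<^sub>v b"

text \<open>Jordan_Normal_Form puts no topology on vectors; convergence is componentwise.\<close>

definition vec_tendsto :: "nat \<Rightarrow> (nat \<Rightarrow> complex vec) \<Rightarrow> complex vec \<Rightarrow> bool" where
  "vec_tendsto n X x \<longleftrightarrow> (\<forall>j<n. (\<lambda>i. X i $ j) \<longlonglongrightarrow> x $ j)"

definition FGS_converges :: "nat \<Rightarrow> complex mat \<Rightarrow> complex vec \<Rightarrow> bool" where
  "FGS_converges n A b \<longleftrightarrow>
     (\<exists>x \<in> carrier_vec n. A *\<^sub>v x = b \<and> (\<forall>y \<in> carrier_vec n. A *\<^sub>v y = b \<longrightarrow> y = x) \<and>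
        (\<forall>x0 \<in> carrier_vec n. vec_tendsto n (FGS_seq A b x0) x))"

section \<open>Ray pattern matrices\<close>

text \<open>
  The conditions are imposed on a choice \<open>\<theta>\<close> of the arguments of the entries; being congruences
  modulo \<open>2\<pi>\<close>, they do not depend on this choice.
\<close>

definition ray_pattern_mat :: "nat \<Rightarrow> real \<Rightarrow> complex mat \<Rightarrow> bool" where
  "ray_pattern_mat n \<psi> P \<longleftrightarrow>
     (\<exists>\<theta> :: nat \<Rightarrow> nat \<Rightarrow> real.
        P = mat n n (\<lambda>(r, s). cis (\<theta> r s)) \<and>
        (\<forall>r<n. \<forall>s<n. r \<noteq> s \<longrightarrow> [\<theta> r s + \<theta> s r = \<psi>] (rmod (2 * pi))) \<and>
        (\<forall>r<n. \<forall>s<n. \<forall>t<n.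
           (r < s \<and> s < t) \<or> (s < t \<and> t < r) \<or> (t < r \<and> r < s) \<longrightarrow>
             [\<theta> r s - \<theta> r t = \<theta> t s + pi] (rmod (2 * pi))) \<and>
        (\<forall>r<n. \<forall>s<n. \<forall>t<n.
           (r < t \<and> t < s) \<or> (t < s \<and> s < r) \<or> (s < r \<and> r < t) \<longrightarrow>
             [\<theta> r s - \<theta> r t = \<theta> t s - \<psi> + pi] (rmod (2 * pi))) \<and>
        (\<forall>r<n. [\<theta> r r = 0] (rmod (2 * pi))))"

definition ray_pattern_class :: "nat \<Rightarrow> real \<Rightarrow> complex mat set" where
  "ray_pattern_class n \<psi> =
     {B \<in> carrier_mat n n. \<exists>\<eta> P. ray_pattern_mat n \<psi> P \<and>
        (\<forall>r<n. \<forall>s<n. B $$ (r, s) = cis \<eta> * of_real (cmod (B $$ (r, s))) * P $$ (r, s))}"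

end

theory Submission
  imports Defs
begin

text \<open>
  Perron--Frobenius theory for the irreducible singular M-matrix \<open>\<mu>(A)\<close> gives positive weights \<open>u\<close>
  with \<open>\<bar>a\<^sub>i\<^sub>i\<bar> u\<^sub>i = (\<Sum>j\<noteq>i. \<bar>a\<^sub>i\<^sub>j\<bar> u\<^sub>j)\<close> for all \<open>i\<close>. An eigenvector \<open>x\<close> of the FGS matrix for an
  eigenvalue \<open>l\<close> solves \<open>l (D - L) x = U x\<close>. If \<open>\<bar>l\<bar> \<ge> 1\<close>, comparing \<open>\<bar>x\<bar>\<close> with \<open>u\<close> at the maximum of
  \<open>\<bar>x\<^sub>i\<bar> / u\<^sub>i\<close> and using irreducibility shows that \<open>\<bar>x\<bar>\<close> is a multiple of \<open>u\<close>, that \<open>\<bar>l\<bar> = 1\<close>, and that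
  every triangle inequality in \<open>l (D - L) x = U x\<close> is an equality. The phases of the entries of
  \<open>D\<^sup>-\<^sup>1 A\<close> are then forced by \<open>l\<close> and the phases of \<open>x\<close>, and the matrices with phases of this form are
  exactly those in the ray pattern class with \<open>\<psi> = arg l\<close>. Conversely, such phases turn \<open>u\<close> into an
  eigenvector for an eigenvalue of modulus \<open>1\<close>.
\<close>

section \<open>Spectral radius and powers\<close>

lemma index_mult_mat_vec_sum:
  assumes "A \<in> carrier_mat n n" "v \<in> carrier_vec n" "i < n"
  shows "(A *\<^sub>v v) $ i = (\<Sum>j<n. A $$ (i, j) * v $ j)"
  using assms by (auto simp: scalar_prod_def lessThan_atLeast0 intro!: sum.cong)

lemma eigenvalue_sumE:
  assumes "(A :: 'a::field mat) \<in> carrier_mat n n" "eigenvalue A l"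
  obtains x k where "k < n" "x k \<noteq> 0" "\<And>i. i < n \<Longrightarrow> (\<Sum>j<n. A $$ (i, j) * x j) = l * x i"
proof -
  obtain v where v: "v \<in> carrier_vec n" "v \<noteq> 0\<^sub>v n" "A *\<^sub>v v = l \<cdot>\<^sub>v v"
    using assms by (auto simp: eigenvalue_def eigenvector_def)
  then obtain k where k: "k < n" "v $ k \<noteq> 0"
    by (metis carrier_vecD eq_vecI index_zero_vec)
  have "(\<Sum>j<n. A $$ (i, j) * v $ j) = l * v $ i" if "i < n" for i
    using index_mult_mat_vec_sum[OF assms(1) v(1) that] v that by simp
  with k show ?thesis using that[of k "vec_index v"] by blast
qed

lemma eigenvalue_sumI:
  assumes "(A :: 'a::field mat) \<in> carrier_mat n n" "k < n" "x k \<noteq> 0"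
    and "\<And>i. i < n \<Longrightarrow> (\<Sum>j<n. A $$ (i, j) * x j) = l * x i"
  shows "eigenvalue A l"
proof -
  have "eigenvector A (vec n x) l"
    unfolding eigenvector_def
  proof (intro conjI)
    show "vec n x \<noteq> 0\<^sub>v (dim_row A)"
      using assms by (metis carrier_matD(1) index_vec index_zero_vec(1))
    show "A *\<^sub>v vec n x = l \<cdot>\<^sub>v vec n x"
    proof (rule eq_vecI)
      fix i assume "i < dim_vec (l \<cdot>\<^sub>v vec n x)"
      then show "(A *\<^sub>v vec n x) $ i = (l \<cdot>\<^sub>v vec n x) $ i"
        using assms index_mult_mat_vec_sum[OF assms(1), of "vec n x" i] by simp
    qed (use assms in auto)
  qed (use assms in auto)
  then show ?thesis by (auto simp: eigenvalue_def)
qed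

lemma cmod_eigenvalue_le_spectral_radius:
  assumes "A \<in> carrier_mat n n" "eigenvalue A l"
  shows "cmod l \<le> spectral_radius A"
  using spectral_radius_mem_max(2)[OF assms(1) eigenvalue_imp_nonzero_dim[OF assms]] assms
  by (auto simp: spectrum_def)

lemma spectral_radius_eigenvalueE:
  assumes "A \<in> carrier_mat n n" "n > 0"
  obtains l where "eigenvalue A l" "cmod l = spectral_radius A"
  using spectral_radius_mem_max(1)[OF assms] by (auto simp: spectrum_def)

text \<open>An eigenvalue \<open>l\<close> of the scaled matrix yields the eigenvalue
  \<open>t * l\<close> of \<open>A\<close>. The scaling carries facts about radius below 1 over to
  an arbitrary threshold \<open>t\<close>.\<close>

lemma spectral_radius_smult_less_1:
  assumes A: "A \<in> carrier_mat n n" "n > 0" and t: "spectral_radius A < t" "t > 0"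
  shows "spectral_radius (complex_of_real (1 / t) \<cdot>\<^sub>m A) < 1"
proof -
  let ?B = "complex_of_real (1 / t) \<cdot>\<^sub>m A"
  have B: "?B \<in> carrier_mat n n" using A by simp
  obtain l where l: "eigenvalue ?B l" "cmod l = spectral_radius ?B"
    using spectral_radius_eigenvalueE[OF B A(2)] .
  obtain x k where x: "k < n" "x k \<noteq> 0"
    and eq: "\<And>i. i < n \<Longrightarrow> (\<Sum>j<n. ?B $$ (i, j) * x j) = l * x i"
    using eigenvalue_sumE[OF B l(1)] by blast
  have "(\<Sum>j<n. A $$ (i, j) * x j) = (t * l) * x i" if "i < n" for i
  proof -
    have "(\<Sum>j<n. A $$ (i, j) * x j) = t * (\<Sum>j<n. ?B $$ (i, j) * x j)"
      using A that t by (simp add: sum_distrib_left)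
    then show ?thesis using eq[OF that] by simp
  qed
  then have "eigenvalue A (t * l)"
    using eigenvalue_sumI[of A n k x "t * l"] A x by blast
  then have "cmod (t * l) < t"
    using cmod_eigenvalue_le_spectral_radius[OF A(1), of "t * l"] t by linarith
  then show ?thesis using l(2) t by (simp add: norm_mult)
qed

lemma smult_pow_mat:
  assumes "(A :: 'a::comm_ring_1 mat) \<in> carrier_mat n n"
  shows "(c \<cdot>\<^sub>m A) ^\<^sub>m k = c ^ k \<cdot>\<^sub>m A ^\<^sub>m k"
proof (induction k)
  case (Suc k)
  have P: "A ^\<^sub>m k \<in> carrier_mat n n" using assms by simp
  have "(c \<cdot>\<^sub>m A) ^\<^sub>m Suc k = (c ^ k \<cdot>\<^sub>m A ^\<^sub>m k) * (c \<cdot>\<^sub>m A)" using Suc by simp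
  also have "\<dots> = c ^ k \<cdot>\<^sub>m (A ^\<^sub>m k * (c \<cdot>\<^sub>m A))"
    using P assms by (intro mult_smult_assoc_mat) auto
  also have "A ^\<^sub>m k * (c \<cdot>\<^sub>m A) = c \<cdot>\<^sub>m (A ^\<^sub>m k * A)"
    using P assms by (intro mult_smult_distrib) auto
  finally show ?case using assms P by (auto simp: mult.assoc mult.commute intro!: eq_matI)
qed (use assms in auto)

text \<open>Radius below 1 bounds the powers; applied to \<open>A\<close> divided by some
  \<open>r\<close> strictly between the radius and 1, that bound becomes the geometric decay
  \<open>c * r ^ k\<close>.\<close>

lemma pow_mat_vec_tendsto_0:
  assumes A: "A \<in> carrier_mat n n" and sr: "spectral_radius A < 1"
    and v: "v \<in> carrier_vec n" and i: "i < n"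
  shows "(\<lambda>k. (A ^\<^sub>m k *\<^sub>v v) $ i) \<longlonglongrightarrow> 0"
proof -
  have n: "n > 0" using i by simp
  obtain l where l: "cmod l = spectral_radius A"
    using spectral_radius_eigenvalueE[OF A n] by metis
  \<comment> \<open>The midpoint is positive even when the radius is 0, so dividing by it is
    safe.\<close>
  define r where "r = (spectral_radius A + 1) / 2"
  have "0 \<le> spectral_radius A" using l by (metis norm_ge_zero)
  then have r: "0 < r" "r < 1" "spectral_radius A < r" using sr by (auto simp: r_def)
  let ?B = "complex_of_real (1 / r) \<cdot>\<^sub>m A"
  have B: "?B \<in> carrier_mat n n" using A by simp
  obtain c where c: "\<And>k. norm_bound (?B ^\<^sub>m k) c"
    using spectral_radius_jnf_norm_bound_less_1_upper_triangular[OF B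
        spectral_radius_smult_less_1[OF A n r(3,1)]] by blast
  have bound: "cmod ((A ^\<^sub>m k) $$ (i, j)) \<le> c * r ^ k" if "j < n" for j k
  proof -
    have "cmod ((?B ^\<^sub>m k) $$ (i, j)) \<le> c"
      using c[of k] i that pow_carrier_mat[OF B, of k] unfolding norm_bound_def
      by (metis carrier_matD)
    moreover have "(?B ^\<^sub>m k) $$ (i, j) = complex_of_real (1 / r) ^ k * (A ^\<^sub>m k) $$ (i, j)"
      using smult_pow_mat[OF A] A i that by simp
    ultimately have "cmod ((A ^\<^sub>m k) $$ (i, j)) / r ^ k \<le> c"
      using r by (simp add: norm_mult norm_power norm_divide power_divide)
    then show ?thesis using r by (simp add: divide_le_eq)
  qed
  have "(\<lambda>k. (A ^\<^sub>m k) $$ (i, j)) \<longlonglongrightarrow> 0" if "j < n" for j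
  proof (rule tendsto_0_le[where K = c])
    show "(\<lambda>k. r ^ k) \<longlonglongrightarrow> 0" using r by (intro LIMSEQ_power_zero) auto
    show "\<forall>\<^sub>F k in sequentially. cmod ((A ^\<^sub>m k) $$ (i, j)) \<le> norm (r ^ k) * c"
      using bound[OF that] r by (simp add: mult.commute)
  qed
  then have "(\<lambda>k. \<Sum>j<n. (A ^\<^sub>m k) $$ (i, j) * v $ j) \<longlonglongrightarrow> (\<Sum>j<n. 0 * v $ j)"
    by (intro tendsto_intros) auto
  then show ?thesis using index_mult_mat_vec_sum[of "A ^\<^sub>m _" n v i] A v i by simp
qed

section \<open>Irreducible nonnegative matrices\<close>

text \<open>If all entries from outside \<open>S\<close> into \<open>S\<close> vanished, listing
  \<open>S\<close> first would exhibit the zero block of a reducible matrix. All later uses of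
  irreducibility go through this form.\<close>

lemma irreducible_mat_connected:
  assumes A: "irreducible_mat n A" and S: "S \<subseteq> {..<n}" "S \<noteq> {}" "S \<noteq> {..<n}"
  obtains i j where "i < n" "i \<notin> S" "j \<in> S" "A $$ (i, j) \<noteq> 0"
proof -
  define k where "k = card S"
  have fin: "finite S" using S finite_subset by blast
  have k: "0 < k" "k < n"
    using S fin psubset_card_mono[of "{..<n}" S] by (auto simp: k_def card_gt_0_iff)
  obtain f where f: "bij_betw f {..<k} S"
    using finite_same_card_bij[of "{..<k}" S] fin by (auto simp: k_def)
  have "card {k..<n} = card ({..<n} - S)" using S fin by (simp add: card_Diff_subset k_def)
  then obtain g where g: "bij_betw g {k..<n} ({..<n} - S)"
    using finite_same_card_bij[of "{k..<n}" "{..<n} - S"] by auto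
  \<comment> \<open>\<open>h\<close> sends the first \<open>k\<close> indices onto \<open>S\<close>,
    the remaining ones below \<open>n\<close> onto its complement, and fixes everything else, as
    \<open>permutes\<close> demands.\<close>
  define h where "h i = (if i < k then f i else if i < n then g i else i)" for i
  have "bij_betw h {..<k} S"
    using f by (rule iffD1[OF bij_betw_cong, rotated]) (auto simp: h_def)
  moreover have hg: "bij_betw h {k..<n} ({..<n} - S)"
    using g by (rule iffD1[OF bij_betw_cong, rotated]) (auto simp: h_def)
  ultimately have "bij_betw h ({..<k} \<union> {k..<n}) (S \<union> ({..<n} - S))"
    by (rule bij_betw_combine) auto
  moreover have "{..<k} \<union> {k..<n} = {..<n}" "S \<union> ({..<n} - S) = {..<n}" using k S by auto
  ultimately have "h permutes {..<n}"
    using k by (intro bij_imp_permutes) (auto simp: h_def)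
  then obtain i j where ij: "k \<le> i" "i < n" "j < k" "A $$ (h i, h j) \<noteq> 0"
    using A k unfolding irreducible_mat_def reducible_mat_def by blast
  have "h i \<in> {..<n} - S" using hg ij by (auto simp: bij_betw_def)
  moreover have "h j \<in> S" using f ij by (auto simp: bij_betw_def h_def)
  ultimately show ?thesis using that[of "h i" "h j"] ij by auto
qed

text \<open>The lower Collatz-Wielandt bound. If \<open>t\<close> exceeded the radius, the powers of
  \<open>B / t\<close> applied to \<open>z\<close> would tend to 0, yet by monotonicity they stay
  above \<open>z\<close>.\<close>

lemma nonneg_supersolution_le_spectral_radius:
  fixes B :: "real mat"
  assumes B: "B \<in> carrier_mat n n" "0\<^sub>m n n \<le> B" and n: "n > 0"
    and z: "\<And>i. i < n \<Longrightarrow> z i > 0" "\<And>i. i < n \<Longrightarrow> t * z i \<le> (\<Sum>j<n. B $$ (i, j) * z j)"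
    and t: "t > 0"
  shows "t \<le> spectral_radius (map_mat complex_of_real B)"
proof (rule ccontr)
  assume "\<not> ?thesis"
  then have lt: "spectral_radius (map_mat complex_of_real B) < t" by simp
  define C where "C = complex_of_real (1 / t) \<cdot>\<^sub>m map_mat complex_of_real B"
  have C: "C \<in> carrier_mat n n" using B by (simp add: C_def)
  have srC: "spectral_radius C < 1"
    unfolding C_def using B n t lt by (intro spectral_radius_smult_less_1) auto
  \<comment> \<open>Allowing any start \<open>w\<close> above \<open>z\<close> makes the induction
    pass: one application of \<open>C\<close> gives a new start \<open>w'\<close> above
    \<open>z\<close>. The witness \<open>y\<close> records that the complex iterates stay
    real.\<close>
  have iter: "\<exists>y. (C ^\<^sub>m k *\<^sub>v vec n (\<lambda>i. complex_of_real (w i))) = vec n (\<lambda>i. complex_of_real (y i))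
      \<and> (\<forall>i<n. z i \<le> y i)" if "\<And>i. i < n \<Longrightarrow> z i \<le> w i" for k and w :: "nat \<Rightarrow> real"
    using that
  proof (induction k arbitrary: w)
    case 0
    then show ?case using C by (intro exI[of _ w]) auto
  next
    case (Suc k)
    define w' where "w' i = (\<Sum>j<n. B $$ (i, j) * w j) / t" for i
    have Cw: "C *\<^sub>v vec n (\<lambda>i. complex_of_real (w i)) = vec n (\<lambda>i. complex_of_real (w' i))"
    proof (rule eq_vecI)
      fix i assume "i < dim_vec (vec n (\<lambda>i. complex_of_real (w' i)))"
      then show "(C *\<^sub>v vec n (\<lambda>i. complex_of_real (w i))) $ i
          = vec n (\<lambda>i. complex_of_real (w' i)) $ i"
        using index_mult_mat_vec_sum[OF C, of "vec n (\<lambda>i. complex_of_real (w i))" i] B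
        by (simp add: C_def w'_def sum_divide_distrib)
    qed (use C in auto)
    have "z i \<le> w' i" if i: "i < n" for i
    proof -
      have "t * z i \<le> (\<Sum>j<n. B $$ (i, j) * z j)" using z i by simp
      also have "\<dots> \<le> (\<Sum>j<n. B $$ (i, j) * w j)"
        using B Suc.prems i by (intro sum_mono mult_left_mono) (auto simp: less_eq_mat_def)
      finally show ?thesis using t by (simp add: w'_def field_simps)
    qed
    moreover have "C ^\<^sub>m Suc k *\<^sub>v vec n (\<lambda>i. complex_of_real (w i))
        = C ^\<^sub>m k *\<^sub>v vec n (\<lambda>i. complex_of_real (w' i))"
      using assoc_mult_mat_vec[OF pow_carrier_mat[OF C] C] Cw by simp
    ultimately show ?case using Suc.IH[of w'] by simp
  qed
  have "(\<lambda>k. (C ^\<^sub>m k *\<^sub>v vec n (\<lambda>i. complex_of_real (z i))) $ 0) \<longlonglongrightarrow> 0"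
    using C srC n by (intro pow_mat_vec_tendsto_0) auto
  then have "(\<lambda>k. Re ((C ^\<^sub>m k *\<^sub>v vec n (\<lambda>i. complex_of_real (z i))) $ 0)) \<longlonglongrightarrow> Re 0"
    by (rule tendsto_Re)
  moreover have "z 0 \<le> Re ((C ^\<^sub>m k *\<^sub>v vec n (\<lambda>i. complex_of_real (z i))) $ 0)" for k
    using iter[of z k] n by auto
  ultimately have "z 0 \<le> 0" using LIMSEQ_le_const by force
  then show False using z n by force
qed

text \<open>\<open>T\<close> is \<open>I + B\<close>. The identity keeps positive coordinates
  positive, and connectedness makes a proper support grow, so the supports eventually fill all
  indices.\<close>

lemma irreducible_iterates_positive:
  fixes B :: "nat \<Rightarrow> nat \<Rightarrow> real"
  assumes conn: "\<And>S. S \<subseteq> {..<n} \<Longrightarrow> S \<noteq> {} \<Longrightarrow> S \<noteq> {..<n} \<Longrightarrow> \<exists>i<n. \<exists>j\<in>S. i \<notin> S \<and> B i j \<noteq> 0"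
    and B: "\<And>i j. i < n \<Longrightarrow> j < n \<Longrightarrow> 0 \<le> B i j"
    and v: "\<And>i. i < n \<Longrightarrow> 0 \<le> v i" "k < n" "v k > 0"
  defines "T \<equiv> \<lambda>w i. w i + (\<Sum>j<n. B i j * w j)"
  shows "\<exists>m. \<forall>m'\<ge>m. \<forall>i<n. 0 < (T ^^ m') v i"
proof -
  have nn: "0 \<le> (T ^^ m) v i" if "i < n" for m i
    using that
  proof (induction m arbitrary: i)
    case (Suc m)
    then show ?case using B by (auto simp: T_def intro!: add_nonneg_nonneg sum_nonneg)
  qed (use v in auto)
  define S where "S m = {i. i < n \<and> 0 < (T ^^ m) v i}" for m
  have card_le: "card (S m) \<le> n" for m
    using card_mono[of "{..<n}" "S m"] by (auto simp: S_def)
  have mono: "S m \<subseteq> S (Suc m)" for m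
    using nn B by (auto simp: S_def T_def intro!: add_pos_nonneg sum_nonneg)
  have k: "k \<in> S m" for m
    by (induction m) (use v mono in \<open>auto simp: S_def\<close>)
  \<comment> \<open>A support of largest cardinality exists because all of them have at most
    \<open>n\<close> elements; it cannot grow any further.\<close>
  obtain m where m: "\<And>m'. card (S m') \<le> card (S m)"
    using card_le ex_has_greatest_nat[of "\<lambda>_. True" 0 "\<lambda>m. card (S m)" "Suc n"]
    by (auto simp: less_Suc_eq_le)
  have "S m = {..<n}"
  proof (rule ccontr)
    assume "S m \<noteq> {..<n}"
    moreover have "S m \<subseteq> {..<n}" by (auto simp: S_def)
    ultimately obtain i j where ij: "i < n" "j \<in> S m" "i \<notin> S m" "B i j \<noteq> 0"
      using conn[of "S m"] k[of m] by blast
    then have j: "j < n" "0 < (T ^^ m) v j" by (auto simp: S_def)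
    have "0 < B i j * (T ^^ m) v j"
      using ij j B[of i j] by (simp add: less_le)
    also have "\<dots> \<le> (\<Sum>j<n. B i j * (T ^^ m) v j)"
      using j nn B ij by (intro member_le_sum) auto
    also have "\<dots> \<le> (T ^^ Suc m) v i" using nn[OF ij(1), of m] by (simp add: T_def)
    finally have "i \<in> S (Suc m)" using ij by (simp add: S_def)
    then have "S m \<subset> S (Suc m)" using mono ij by blast
    then have "card (S m) < card (S (Suc m))"
      by (intro psubset_card_mono) (auto simp: S_def)
    with m[of "Suc m"] show False by simp
  qed
  then have "{..<n} \<subseteq> S m'" if "m \<le> m'" for m'
    using lift_Suc_mono_le[of S, OF mono that] by simp
  then show ?thesis by (intro exI[of _ m]) (auto simp: S_def)
qed

text \<open>Taking moduli in the equation of an eigenvector whose eigenvalue has modulus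
  \<open>s\<close> gives \<open>s * y i \<le> M y i\<close>. Maximality of \<open>s\<close> turns
  this into equality, and positivity comes from the iterates of \<open>I + B\<close>.\<close>

lemma perron_vector:
  fixes B :: "real mat"
  assumes B: "B \<in> carrier_mat n n" "0\<^sub>m n n \<le> B" and n: "n > 0"
    and conn: "\<And>S. S \<subseteq> {..<n} \<Longrightarrow> S \<noteq> {} \<Longrightarrow> S \<noteq> {..<n} \<Longrightarrow>
      \<exists>i<n. \<exists>j\<in>S. i \<notin> S \<and> B $$ (i, j) \<noteq> 0"
  defines "s \<equiv> spectral_radius (map_mat complex_of_real B)"
  obtains u where "\<And>i. i < n \<Longrightarrow> u i > 0"
    and "\<And>i. i < n \<Longrightarrow> (\<Sum>j<n. B $$ (i, j) * u j) = s * u i"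
proof -
  let ?C = "map_mat complex_of_real B"
  have C: "?C \<in> carrier_mat n n" using B by simp
  have B0: "0 \<le> B $$ (i, j)" if "i < n" "j < n" for i j
    using B that by (auto simp: less_eq_mat_def)
  obtain l where l: "eigenvalue ?C l" "cmod l = s"
    using spectral_radius_eigenvalueE[OF C n] s_def by metis
  obtain x k where k: "k < n" "x k \<noteq> 0"
    and x: "\<And>i. i < n \<Longrightarrow> (\<Sum>j<n. ?C $$ (i, j) * x j) = l * x i"
    using eigenvalue_sumE[OF C l(1)] by blast
  define y where "y i = cmod (x i)" for i
  define M where "M w i = (\<Sum>j<n. B $$ (i, j) * w j)" for w i
  define T where "T = (\<lambda>w i. w i + M w i)"
  have M_diff: "M (\<lambda>i. f i - c * g i) i = M f i - c * M g i" for f c g i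
    by (simp add: M_def algebra_simps sum_subtractf sum_distrib_left)
  have M_add: "M (\<lambda>i. f i + g i) i = M f i + M g i" for f g i
    by (simp add: M_def algebra_simps sum.distrib)
  have T_def': "T = (\<lambda>w i. w i + (\<Sum>j<n. B $$ (i, j) * w j))"
    by (simp add: T_def M_def)
  have My: "s * y i \<le> M y i" if "i < n" for i
  proof -
    have "s * y i = cmod (\<Sum>j<n. ?C $$ (i, j) * x j)"
      using x[OF that] l by (simp add: y_def norm_mult)
    also have "\<dots> \<le> (\<Sum>j<n. cmod (?C $$ (i, j) * x j))" by (rule norm_sum)
    also have "\<dots> = M y i"
      using B B0 that by (auto simp: M_def y_def norm_mult intro!: sum.cong)
    finally show ?thesis .
  qed
  have s0: "s \<ge> 0" using l by (metis norm_ge_zero)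
  \<comment> \<open>The defect in \<open>s * y i \<le> M y i\<close>. Since \<open>T = I + M\<close>
    commutes with \<open>M\<close>, the iterates of \<open>d\<close> are the defects of the iterates
    of \<open>y\<close>.\<close>
  define d where "d = (\<lambda>i. M y i - s * y i)"
  have Md: "(T ^^ m) d = (\<lambda>i. M ((T ^^ m) y) i - s * (T ^^ m) y i)" for m
  proof (induction m)
    case (Suc m)
    show ?case unfolding funpow.simps o_def Suc.IH
      by (simp add: T_def M_diff M_add algebra_simps)
  qed (simp add: d_def)
  have evpos: "\<exists>m. \<forall>m'\<ge>m. \<forall>i<n. 0 < (T ^^ m') w i"
    if "\<And>i. i < n \<Longrightarrow> 0 \<le> w i" "k < n" "w k > 0" for w k
    using irreducible_iterates_positive[of n "\<lambda>i j. B $$ (i, j)" w k, folded T_def', OF conn B0 that]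
    by blast
  obtain m where m: "\<And>m' i. m \<le> m' \<Longrightarrow> i < n \<Longrightarrow> 0 < (T ^^ m') y i"
    using evpos[of y k] k by (auto simp: y_def)
  \<comment> \<open>Otherwise an iterate of \<open>y\<close> under \<open>I + B\<close> is a strict supersolution, forcing a radius above \<open>s\<close>.\<close>
  have eq: "M y i = s * y i" if i: "i < n" for i
  proof (rule ccontr)
    assume "M y i \<noteq> s * y i"
    then have "d i > 0" using My[OF i] by (simp add: d_def)
    moreover have "0 \<le> d j" if "j < n" for j using My[OF that] by (simp add: d_def)
    ultimately obtain m2 where m2: "\<And>m' i. m2 \<le> m' \<Longrightarrow> i < n \<Longrightarrow> 0 < (T ^^ m') d i"
      using evpos[of d i] i by auto
    \<comment> \<open>Enough iterations to make both the iterate of \<open>y\<close> and its defect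
      positive in every coordinate.\<close>
    define z where "z = (T ^^ (m + m2)) y"
    have z: "0 < z i" "s * z i < M z i" if "i < n" for i
      using that m[of "m + m2" i] m2[of "m + m2" i] Md[of "m + m2"] by (auto simp: z_def)
    \<comment> \<open>The least quotient is one factor valid in all rows, and it still exceeds
      \<open>s\<close> because the minimum over finitely many rows is attained.\<close>
    define t where "t = Min ((\<lambda>i. M z i / z i) ` {..<n})"
    have "s < t" unfolding t_def
      using n z by (subst Min_gr_iff) (auto simp: pos_less_divide_eq)
    moreover have "t * z i \<le> M z i" if "i < n" for i
    proof -
      have "t \<le> M z i / z i" unfolding t_def using that by (intro Min_le) auto
      then show ?thesis using z[OF that] by (simp add: pos_le_divide_eq)
    qed
    moreover from \<open>s < t\<close> have "0 < t" using s0 by linarith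
    ultimately have "t \<le> s" unfolding s_def
      using z by (intro nonneg_supersolution_le_spectral_radius[OF B n, of z])
        (auto simp: M_def)
    with \<open>s < t\<close> show False by simp
  qed
  \<comment> \<open>Now \<open>y\<close> is an eigenvector of \<open>I + B\<close> for
    \<open>1 + s\<close>, so the positivity of an iterate passes back to \<open>y\<close>.\<close>
  have "(T ^^ k) y i = (1 + s) ^ k * y i" if "i < n" for k i
    using that
  proof (induction k arbitrary: i)
    case (Suc k)
    have "M ((T ^^ k) y) i = (1 + s) ^ k * M y i"
      using Suc by (simp add: M_def sum_distrib_left mult_ac)
    then show ?case using Suc eq by (simp add: T_def algebra_simps)
  qed simp
  then have "y i > 0" if "i < n" for i
    using m[of m i] that s0 by (simp add: zero_less_mult_iff)
  then show ?thesis using that eq by (auto simp: M_def)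
qed

section \<open>The Gauss--Seidel splitting\<close>

lemma inv_mat_det_nonzero:
  assumes A: "(A :: 'a::field mat) \<in> carrier_mat n n" and d: "det A \<noteq> 0"
  shows "inv_mat A \<in> carrier_mat n n" "A * inv_mat A = 1\<^sub>m n" "inv_mat A * A = 1\<^sub>m n"
proof -
  obtain B where "mat_inverse A = Some B"
    using mat_inverse(1)[OF A, where b = "()"] det_non_zero_imp_unit[OF A d, of "()"]
    by (cases "mat_inverse A") auto
  then show "inv_mat A \<in> carrier_mat n n" "A * inv_mat A = 1\<^sub>m n" "inv_mat A * A = 1\<^sub>m n"
    using mat_inverse(2)[OF A] by (auto simp: inv_mat_def)
qed

lemma lower_triangular_det_nonzero:
  assumes "(A :: 'a::field mat) \<in> carrier_mat n n"
    and "\<And>i j. i < j \<Longrightarrow> j < n \<Longrightarrow> A $$ (i, j) = 0"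
    and "\<And>i. i < n \<Longrightarrow> A $$ (i, i) \<noteq> 0"
  shows "det A \<noteq> 0"
  using det_lower_triangular[of n A] assms by (auto simp: diag_mat_def prod_list_zero_iff)

lemma inv_mat_diag_part_mult_index:
  assumes A: "(A :: 'a::field mat) \<in> carrier_mat n n"
    and nz: "\<And>i. i < n \<Longrightarrow> A $$ (i, i) \<noteq> 0" and ij: "i < n" "j < n"
  shows "(inv_mat (diag_part A) * A) $$ (i, j) = A $$ (i, j) / A $$ (i, i)"
proof -
  let ?D = "diag_part A"
  have D: "?D \<in> carrier_mat n n" using A by (simp add: diag_part_def)
  have "det ?D \<noteq> 0"
    using A nz by (intro lower_triangular_det_nonzero[OF D]) (auto simp: diag_part_def)
  note inv = inv_mat_det_nonzero[OF D this]
  define C where "C = inv_mat ?D * A"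
  have C: "C \<in> carrier_mat n n" using inv A by (simp add: C_def)
  \<comment> \<open>\<open>C\<close> is read off from this product, each entry of which has a single
    nonzero term at most, rather than from a formula for the inverse.\<close>
  have "?D * C = A" unfolding C_def using assoc_mult_mat[OF D inv(1) A] inv A by simp
  then have "A $$ (i, j) = (?D * C) $$ (i, j)" by simp
  also have "\<dots> = (\<Sum>k<n. ?D $$ (i, k) * C $$ (k, j))"
    using ij D C by (auto simp: scalar_prod_def lessThan_atLeast0)
  also have "\<dots> = (\<Sum>k<n. if k = i then A $$ (i, i) * C $$ (i, j) else 0)"
    using A ij by (intro sum.cong) (auto simp: diag_part_def)
  also have "\<dots> = A $$ (i, i) * C $$ (i, j)" using ij by simp
  finally show ?thesis using nz[OF ij(1)] by (simp add: C_def)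
qed

section \<open>The forward Gauss-Seidel iteration: eigenvalue equations and convergence\<close>

context
  fixes n :: nat and A :: "complex mat"
  assumes A: "A \<in> carrier_mat n n" and diag_nonzero: "\<forall>i<n. A $$ (i, i) \<noteq> 0"
begin

lemma DL_inverse:
  shows "diag_part A - lower_part A \<in> carrier_mat n n"
    and "inv_mat (diag_part A - lower_part A) \<in> carrier_mat n n"
    and "(diag_part A - lower_part A) * inv_mat (diag_part A - lower_part A) = 1\<^sub>m n"
    and "inv_mat (diag_part A - lower_part A) * (diag_part A - lower_part A) = 1\<^sub>m n"
proof -
  show DL: "diag_part A - lower_part A \<in> carrier_mat n n"
    using A by (simp add: diag_part_def lower_part_def minus_mat_def)
  have "det (diag_part A - lower_part A) \<noteq> 0"
    using A diag_nonzero
    by (intro lower_triangular_det_nonzero[OF DL]) (auto simp: diag_part_def lower_part_def)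
  from inv_mat_det_nonzero[OF DL this]
  show "inv_mat (diag_part A - lower_part A) \<in> carrier_mat n n"
    "(diag_part A - lower_part A) * inv_mat (diag_part A - lower_part A) = 1\<^sub>m n"
    "inv_mat (diag_part A - lower_part A) * (diag_part A - lower_part A) = 1\<^sub>m n" .
qed

lemma upper_part_carrier: "upper_part A \<in> carrier_mat n n"
  using A by (simp add: upper_part_def)

lemma FGS_mat_carrier: "FGS_mat A \<in> carrier_mat n n"
  using DL_inverse upper_part_carrier unfolding FGS_mat_def by simp

lemma FGS_mat_vec_eq_iff:
  assumes v: "v \<in> carrier_vec n" and w: "w \<in> carrier_vec n"
  shows "FGS_mat A *\<^sub>v v = w \<longleftrightarrow> upper_part A *\<^sub>v v = (diag_part A - lower_part A) *\<^sub>v w"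
proof -
  let ?L = "diag_part A - lower_part A"
  note L = DL_inverse and U = upper_part_carrier
  have H: "FGS_mat A *\<^sub>v v = inv_mat ?L *\<^sub>v (upper_part A *\<^sub>v v)"
    using L U v unfolding FGS_mat_def by simp
  have Uv: "upper_part A *\<^sub>v v \<in> carrier_vec n" using U v by simp
  show ?thesis
  proof
    assume "FGS_mat A *\<^sub>v v = w"
    then have "?L *\<^sub>v w = (?L * inv_mat ?L) *\<^sub>v (upper_part A *\<^sub>v v)"
      using H assoc_mult_mat_vec[OF L(1,2) Uv] by simp
    then show "upper_part A *\<^sub>v v = ?L *\<^sub>v w" using L Uv by simp
  next
    assume "upper_part A *\<^sub>v v = ?L *\<^sub>v w"
    then have "FGS_mat A *\<^sub>v v = (inv_mat ?L * ?L) *\<^sub>v w"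
      using H assoc_mult_mat_vec[OF L(2,1) w] by simp
    then show "FGS_mat A *\<^sub>v v = w" using L w by simp
  qed
qed

lemma mult_vec_splitting:
  assumes "v \<in> carrier_vec n"
  shows "A *\<^sub>v v = (diag_part A - lower_part A) *\<^sub>v v - upper_part A *\<^sub>v v"
proof -
  have "A = diag_part A - lower_part A - upper_part A"
    using A by (intro eq_matI) (auto simp: diag_part_def lower_part_def upper_part_def)
  then show ?thesis
    using minus_mult_distrib_mat_vec[OF DL_inverse(1) upper_part_carrier assms] by simp
qed

text \<open>Clearing the inverse leaves \<open>(l (D - L) - U) x = 0\<close>. As \<open>D\<close>,
  \<open>-L\<close> and \<open>-U\<close> are the diagonal, lower and upper parts of
  \<open>A\<close> itself, row \<open>i\<close> carries the factor \<open>l\<close> exactly at the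
  columns \<open>j \<le> i\<close>.\<close>

lemma FGS_eigenvector_iff:
  assumes i: "\<And>i. i < n \<Longrightarrow> v $ i = x i" and v: "v \<in> carrier_vec n"
  shows "FGS_mat A *\<^sub>v v = l \<cdot>\<^sub>v v \<longleftrightarrow>
    (\<forall>i<n. (\<Sum>j<n. (if j \<le> i then l else 1) * A $$ (i, j) * x j) = 0)"
proof -
  let ?L = "diag_part A - lower_part A" and ?U = "upper_part A"
  have lv: "l \<cdot>\<^sub>v v \<in> carrier_vec n" using v by simp
  have row: "(?L *\<^sub>v (l \<cdot>\<^sub>v v)) $ i - (?U *\<^sub>v v) $ i =
      (\<Sum>j<n. (if j \<le> i then l else 1) * A $$ (i, j) * x j)" if "i < n" for i
    unfolding index_mult_mat_vec_sum[OF DL_inverse(1) lv that]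
      index_mult_mat_vec_sum[OF upper_part_carrier v that] sum_subtractf[symmetric]
    using A v that assms
    by (intro sum.cong) (auto simp: diag_part_def lower_part_def upper_part_def)
  have "FGS_mat A *\<^sub>v v = l \<cdot>\<^sub>v v \<longleftrightarrow> (\<forall>i<n. (?U *\<^sub>v v) $ i = (?L *\<^sub>v (l \<cdot>\<^sub>v v)) $ i)"
    unfolding FGS_mat_vec_eq_iff[OF v lv]
    using DL_inverse(1) upper_part_carrier
    by (metis carrier_matD(1) dim_mult_mat_vec eq_vecI)
  also have "\<dots> \<longleftrightarrow> (\<forall>i<n. (?L *\<^sub>v (l \<cdot>\<^sub>v v)) $ i - (?U *\<^sub>v v) $ i = 0)"
    by (metis right_minus_eq)
  finally show ?thesis using row by simp
qed

lemma FGS_eigenvalue_iff: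
  "eigenvalue (FGS_mat A) l \<longleftrightarrow>
    (\<exists>x. (\<exists>k<n. x k \<noteq> 0) \<and>
      (\<forall>i<n. (\<Sum>j<n. (if j \<le> i then l else 1) * A $$ (i, j) * x j) = 0))"
  (is "?L \<longleftrightarrow> ?R")
proof
  assume ?L
  then obtain v where v: "v \<in> carrier_vec n" "v \<noteq> 0\<^sub>v n" "FGS_mat A *\<^sub>v v = l \<cdot>\<^sub>v v"
    using FGS_mat_carrier by (auto simp: eigenvalue_def eigenvector_def)
  then have "\<exists>k<n. v $ k \<noteq> 0" by (metis carrier_vecD eq_vecI index_zero_vec)
  with v show ?R using FGS_eigenvector_iff[of v "vec_index v" l] by blast
next
  assume ?R
  then obtain x k where x: "k < n" "x k \<noteq> 0"
    "\<forall>i<n. (\<Sum>j<n. (if j \<le> i then l else 1) * A $$ (i, j) * x j) = 0" by blast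
  have "vec n x \<noteq> 0\<^sub>v n" using x by (metis index_vec index_zero_vec(1))
  moreover have "FGS_mat A *\<^sub>v vec n x = l \<cdot>\<^sub>v vec n x"
    using FGS_eigenvector_iff[of "vec n x" x l] x by simp
  ultimately have "eigenvector (FGS_mat A) (vec n x) l"
    using FGS_mat_carrier by (simp add: eigenvector_def)
  then show ?L by (auto simp: eigenvalue_def)
qed

text \<open>\<open>x\<close> is a fixed point of the scheme with right-hand side
  \<open>A *\<^sub>v x\<close>, so each step multiplies the error by the iteration matrix.\<close>

lemma FGS_seq_error:
  assumes x: "x \<in> carrier_vec n" and v: "v \<in> carrier_vec n"
  shows "FGS_seq A (A *\<^sub>v x) (x + v) k = x + FGS_mat A ^\<^sub>m k *\<^sub>v v"
proof -
  let ?L = "diag_part A - lower_part A" and ?U = "upper_part A" and ?H = "FGS_mat A"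
  note L = DL_inverse and U = upper_part_carrier and H = FGS_mat_carrier
  \<comment> \<open>Matrix powers append the new factor on the right, whereas the iteration applies
    it on the left.\<close>
  have pow_Suc: "?H ^\<^sub>m Suc k = ?H * ?H ^\<^sub>m k" for k
  proof (induction k)
    case (Suc k)
    then show ?case using assoc_mult_mat[OF H pow_carrier_mat[OF H] H, of k] by simp
  qed (use H in simp)
  have Ux: "?U *\<^sub>v x \<in> carrier_vec n" and Lx: "?L *\<^sub>v x \<in> carrier_vec n"
    using U L x by auto
  have Hx: "?H *\<^sub>v x \<in> carrier_vec n" using H x by simp
  have "inv_mat ?L *\<^sub>v (A *\<^sub>v x) = inv_mat ?L *\<^sub>v (?L *\<^sub>v x) - inv_mat ?L *\<^sub>v (?U *\<^sub>v x)"
    unfolding mult_vec_splitting[OF x] using mult_minus_distrib_mat_vec[OF L(2) Lx Ux] .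
  also have "inv_mat ?L *\<^sub>v (?L *\<^sub>v x) = x"
    using assoc_mult_mat_vec[OF L(2,1) x] L x by simp
  also have "inv_mat ?L *\<^sub>v (?U *\<^sub>v x) = ?H *\<^sub>v x"
    unfolding FGS_mat_def using assoc_mult_mat_vec[OF L(2) U x] by simp
  finally have b: "inv_mat ?L *\<^sub>v (A *\<^sub>v x) = x - ?H *\<^sub>v x" .
  show ?thesis
  proof (induction k)
    case 0
    then show ?case using H v x by simp
  next
    case (Suc k)
    have e: "?H ^\<^sub>m k *\<^sub>v v \<in> carrier_vec n" using H v by (meson mult_mat_vec_carrier pow_carrier_mat)
    have "FGS_seq A (A *\<^sub>v x) (x + v) (Suc k)
        = ?H *\<^sub>v x + ?H *\<^sub>v (?H ^\<^sub>m k *\<^sub>v v) + (x - ?H *\<^sub>v x)"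
      using Suc b mult_add_distrib_mat_vec[OF H x e] by simp
    also have "?H *\<^sub>v (?H ^\<^sub>m k *\<^sub>v v) = ?H ^\<^sub>m Suc k *\<^sub>v v"
      unfolding pow_Suc using assoc_mult_mat_vec[OF H pow_carrier_mat[OF H] v] by simp
    also have "?H *\<^sub>v x + ?H ^\<^sub>m Suc k *\<^sub>v v + (x - ?H *\<^sub>v x) = x + ?H ^\<^sub>m Suc k *\<^sub>v v"
      using Hx x H v by (intro eq_vecI) auto
    finally show ?case .
  qed
qed

text \<open>Starting from the solution plus an eigenvector \<open>v\<close> for an eigenvalue
  \<open>l\<close> of largest modulus, the error is \<open>l ^ i\<close> times \<open>v\<close>, so
  convergence forces \<open>cmod l < 1\<close>. Conversely, radius below 1 excludes the eigenvalue
  1, which makes \<open>A\<close> invertible, and the error tends to 0.\<close>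

lemma FGS_converges_iff:
  assumes n: "n > 0" and b: "b \<in> carrier_vec n"
  shows "FGS_converges n A b \<longleftrightarrow> spectral_radius (FGS_mat A) < 1"
proof
  assume "FGS_converges n A b"
  then obtain x where x: "x \<in> carrier_vec n" "A *\<^sub>v x = b"
    and lim: "\<And>x0. x0 \<in> carrier_vec n \<Longrightarrow> vec_tendsto n (FGS_seq A b x0) x"
    unfolding FGS_converges_def by blast
  obtain l where l: "eigenvalue (FGS_mat A) l" "cmod l = spectral_radius (FGS_mat A)"
    using spectral_radius_eigenvalueE[OF FGS_mat_carrier n] .
  then obtain v where ev: "eigenvector (FGS_mat A) v l" by (auto simp: eigenvalue_def)
  then have v: "v \<in> carrier_vec n" "v \<noteq> 0\<^sub>v n"
    using FGS_mat_carrier by (auto simp: eigenvector_def)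
  then obtain k where k: "k < n" "v $ k \<noteq> 0"
    by (metis carrier_vecD eq_vecI index_zero_vec)
  have "FGS_seq A b (x + v) i $ k = x $ k + l ^ i * v $ k" for i
    using FGS_seq_error[OF x(1) v(1), of i] eigenvector_pow[OF FGS_mat_carrier ev, of i] x v k
    by simp
  moreover have "(\<lambda>i. FGS_seq A b (x + v) i $ k) \<longlonglongrightarrow> x $ k"
    using lim[of "x + v"] x v k by (simp add: vec_tendsto_def)
  ultimately have "(\<lambda>i. x $ k + l ^ i * v $ k) \<longlonglongrightarrow> x $ k" by simp
  then have "(\<lambda>i. (x $ k + l ^ i * v $ k - x $ k) / v $ k) \<longlonglongrightarrow> (x $ k - x $ k) / v $ k"
    by (intro tendsto_intros k)
  then have "(\<lambda>i. l ^ i) \<longlonglongrightarrow> 0" using k by simp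
  then have lim0: "(\<lambda>i. cmod l ^ i) \<longlonglongrightarrow> 0" using tendsto_norm_zero by (fastforce simp: norm_power)
  show "spectral_radius (FGS_mat A) < 1"
  proof (rule ccontr)
    assume "\<not> ?thesis"
    then have "1 \<le> cmod l ^ i" for i using l by (simp add: one_le_power)
    then have "(1::real) \<le> 0" using LIMSEQ_le_const[OF lim0] by blast
    then show False by simp
  qed
next
  assume sr: "spectral_radius (FGS_mat A) < 1"
  \<comment> \<open>A null vector of \<open>A\<close> satisfies \<open>U v = (D - L) v\<close>, so
    the iteration matrix fixes it.\<close>
  have zero: "v = 0\<^sub>v n" if v: "v \<in> carrier_vec n" "A *\<^sub>v v = 0\<^sub>v n" for v
  proof (rule ccontr)
    assume "v \<noteq> 0\<^sub>v n"
    have dims: "dim_vec (upper_part A *\<^sub>v v) = n"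
        "dim_vec ((diag_part A - lower_part A) *\<^sub>v v) = n"
      using DL_inverse(1) upper_part_carrier by auto
    have "upper_part A *\<^sub>v v = (diag_part A - lower_part A) *\<^sub>v v"
    proof (rule eq_vecI)
      fix i assume "i < dim_vec ((diag_part A - lower_part A) *\<^sub>v v)"
      then have "i < n" using dims by simp
      then have "((diag_part A - lower_part A) *\<^sub>v v - upper_part A *\<^sub>v v) $ i = 0"
        unfolding mult_vec_splitting[OF v(1), symmetric] v(2) by simp
      then show "(upper_part A *\<^sub>v v) $ i = ((diag_part A - lower_part A) *\<^sub>v v) $ i"
        using \<open>i < n\<close> dims by (metis index_minus_vec(1) right_minus_eq)
    qed (use dims in simp)
    then have "FGS_mat A *\<^sub>v v = 1 \<cdot>\<^sub>v v" using FGS_mat_vec_eq_iff[of v v] v by simp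
    then have "eigenvalue (FGS_mat A) 1"
      using v \<open>v \<noteq> 0\<^sub>v n\<close> FGS_mat_carrier by (auto simp: eigenvalue_def eigenvector_def)
    then show False using cmod_eigenvalue_le_spectral_radius[OF FGS_mat_carrier] sr by fastforce
  qed
  then have "det A \<noteq> 0" using det_0_iff_vec_prod_zero[OF A] by blast
  note inv = inv_mat_det_nonzero[OF A this]
  define x where "x = inv_mat A *\<^sub>v b"
  have x: "x \<in> carrier_vec n" "A *\<^sub>v x = b"
    using inv b assoc_mult_mat_vec[OF A inv(1) b] by (auto simp: x_def)
  show "FGS_converges n A b"
    unfolding FGS_converges_def
  proof (intro bexI[of _ x] conjI ballI impI)
    fix y assume y: "y \<in> carrier_vec n" "A *\<^sub>v y = b"
    have "A *\<^sub>v (y - x) = 0\<^sub>v n"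
      using mult_minus_distrib_mat_vec[OF A y(1) x(1)] x y b by simp
    then have yx: "y - x = 0\<^sub>v n" using zero[of "y - x"] x y by simp
    show "y = x"
    proof (rule eq_vecI)
      fix i assume "i < dim_vec x"
      then have "(y - x) $ i = 0" "i < n" using x unfolding yx by auto
      then show "y $ i = x $ i" using x y by simp
    qed (use x y in auto)
  next
    fix x0 :: "complex vec" assume x0: "x0 \<in> carrier_vec n"
    have x0': "x + (x0 - x) = x0" using x x0 by (intro eq_vecI) auto
    have e: "x0 - x \<in> carrier_vec n" using x x0 by simp
    show "vec_tendsto n (FGS_seq A b x0) x"
      unfolding vec_tendsto_def
    proof (intro allI impI)
      fix j assume j: "j < n"
      have "(\<lambda>k. x $ j + (FGS_mat A ^\<^sub>m k *\<^sub>v (x0 - x)) $ j) \<longlonglongrightarrow> x $ j + 0"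
        using pow_mat_vec_tendsto_0[OF FGS_mat_carrier sr e j] by (intro tendsto_intros)
      moreover have "FGS_seq A b x0 k $ j = x $ j + (FGS_mat A ^\<^sub>m k *\<^sub>v (x0 - x)) $ j" for k
        using FGS_seq_error[OF x(1) e, of k] x0' x(2) j FGS_mat_carrier by simp
      ultimately show "(\<lambda>i. FGS_seq A b x0 i $ j) \<longlonglongrightarrow> x $ j" by simp
    qed
  qed (use x in auto)
qed

end

section \<open>Perron weights of a mixed H-matrix, and equality in the triangle inequality\<close>

lemma mixed_H_matrix_weights:
  assumes H: "A \<in> mixed_H_matrices n" and irr: "irreducible_mat n A" and n: "n > 0"
  obtains u where "\<And>i. i < n \<Longrightarrow> u i > 0"
    and "\<And>i. i < n \<Longrightarrow> cmod (A $$ (i, i)) * u i = (\<Sum>j\<in>{..<n} - {i}. cmod (A $$ (i, j)) * u j)"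
proof -
  have A: "A \<in> carrier_mat n n" using H by (simp add: mixed_H_matrices_def)
  obtain s B where B: "B \<in> carrier_mat n n" "0\<^sub>m n n \<le> B"
    and M: "comparison_mat A = s \<cdot>\<^sub>m 1\<^sub>m n - B"
    and s: "s = spectral_radius (map_mat complex_of_real B)"
    using H by (auto simp: mixed_H_matrices_def singular_M_matrix_def)
  \<comment> \<open>Off the diagonal \<open>B\<close> consists of the moduli of the entries of
    \<open>A\<close>, so it inherits their connectedness; on the diagonal it is \<open>s\<close>
    minus those moduli.\<close>
  have entry: "(if i = j then cmod (A $$ (i, i)) else - cmod (A $$ (i, j)))
      = (if i = j then s else 0) - B $$ (i, j)" if "i < n" "j < n" for i j
    using arg_cong[OF M, of "\<lambda>X. X $$ (i, j)"] that A B by (auto simp: comparison_mat_def)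
  have conn: "\<exists>i<n. \<exists>j\<in>S. i \<notin> S \<and> B $$ (i, j) \<noteq> 0"
    if S: "S \<subseteq> {..<n}" "S \<noteq> {}" "S \<noteq> {..<n}" for S
  proof -
    obtain i j where "i < n" "i \<notin> S" "j \<in> S" "A $$ (i, j) \<noteq> 0"
      using irreducible_mat_connected[OF irr S] .
    then have "i < n" "j \<in> S" "i \<notin> S" "B $$ (i, j) \<noteq> 0"
      using entry[of i j] S by (auto split: if_splits)
    then show ?thesis by blast
  qed
  obtain u where u: "\<And>i. i < n \<Longrightarrow> u i > 0"
    "\<And>i. i < n \<Longrightarrow> (\<Sum>j<n. B $$ (i, j) * u j) = s * u i"
    using perron_vector[OF B n conn] s by blast
  \<comment> \<open>The diagonal term of the Perron equation moves to the other side, where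
    \<open>s - B $$ (i, i)\<close> is the modulus of the diagonal entry of \<open>A\<close>.\<close>
  have "cmod (A $$ (i, i)) * u i = (\<Sum>j\<in>{..<n} - {i}. cmod (A $$ (i, j)) * u j)" if i: "i < n" for i
  proof -
    have "s * u i = B $$ (i, i) * u i + (\<Sum>j\<in>{..<n} - {i}. B $$ (i, j) * u j)"
      unfolding u(2)[OF i, symmetric] using i by (intro sum.remove) auto
    also have "(\<Sum>j\<in>{..<n} - {i}. B $$ (i, j) * u j) = (\<Sum>j\<in>{..<n} - {i}. cmod (A $$ (i, j)) * u j)"
    proof (rule sum.cong)
      fix j assume "j \<in> {..<n} - {i}"
      then show "B $$ (i, j) * u j = cmod (A $$ (i, j)) * u j" using entry[OF i, of j] by auto
    qed simp
    finally have "s * u i = B $$ (i, i) * u i + (\<Sum>j\<in>{..<n} - {i}. cmod (A $$ (i, j)) * u j)" .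
    moreover have "s = cmod (A $$ (i, i)) + B $$ (i, i)" using entry[OF i i] by simp
    then have "s * u i = cmod (A $$ (i, i)) * u i + B $$ (i, i) * u i" by (simp only: distrib_right)
    ultimately show ?thesis by linarith
  qed
  with u(1) that show ?thesis by blast
qed

text \<open>With \<open>w\<close> the sum, each gap
  \<open>cmod w * cmod (f j) - Re (cnj w * f j)\<close> is nonnegative and the gaps add up to 0, so
  every summand points along \<open>w\<close>. The conclusion is free of quotients so as to cover
  \<open>w = 0\<close> and vanishing summands.\<close>

lemma norm_sum_eq_sum_norm_aligned:
  fixes f :: "'b \<Rightarrow> complex"
  assumes fin: "finite S" and eq: "cmod (sum f S) = (\<Sum>j\<in>S. cmod (f j))" and k: "k \<in> S"
  shows "f k * cmod (sum f S) = cmod (f k) * sum f S"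
proof -
  define w where "w = sum f S"
  have le: "Re (cnj w * f j) \<le> cmod w * cmod (f j)" for j
    by (metis complex_Re_le_cmod complex_mod_cnj norm_mult)
  have ww: "cnj w * w = complex_of_real (cmod w * cmod w)"
    by (metis complex_norm_square mult.commute power2_eq_square)
  have "(\<Sum>j\<in>S. cmod w * cmod (f j) - Re (cnj w * f j)) = cmod w * cmod w - Re (cnj w * w)"
    unfolding sum_subtractf sum_distrib_left[symmetric] eq[symmetric] Re_sum[symmetric] w_def ..
  also have "\<dots> = 0" unfolding ww by simp
  finally have "\<forall>j\<in>S. cmod w * cmod (f j) - Re (cnj w * f j) = 0"
    using le by (subst (asm) sum_nonneg_eq_0_iff[OF fin]) auto
  then have "Re (cnj w * f k) = cmod (cnj w * f k)"
    using k unfolding norm_mult complex_mod_cnj by simp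
  \<comment> \<open>A number whose real part equals its modulus is real.\<close>
  then have "Im (cnj w * f k) = 0" by (metis cmod_power2 add_cancel_left_right zero_eq_power2)
  with \<open>Re (cnj w * f k) = cmod (cnj w * f k)\<close>
  have "cnj w * f k = complex_of_real (cmod w * cmod (f k))"
    unfolding complex_eq_iff norm_mult complex_mod_cnj by simp
  then have "(cnj w * w) * f k = complex_of_real (cmod w * cmod (f k)) * w"
    by (metis mult.assoc mult.commute)
  then have "cmod w * (cmod w * f k) = cmod w * (cmod (f k) * w)"
    unfolding ww by (simp add: mult.assoc)
  then show ?thesis unfolding w_def[symmetric] by (cases "w = 0") (auto simp: mult.commute)
qed

section \<open>Ray patterns and eigenvalues on the unit circle\<close>

text \<open>
  The diagonal of \<open>c\<close> is unconstrained; with \<open>l = cis \<psi>\<close> and unit diagonal this is membership in the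
  \<open>\<psi>\<close>-ray pattern class, the \<open>\<xi>\<close> being the phases of an FGS eigenvector for the eigenvalue \<open>l\<close>.
\<close>

definition phase_factorization :: "nat \<Rightarrow> (nat \<Rightarrow> nat \<Rightarrow> complex) \<Rightarrow> complex \<Rightarrow> (nat \<Rightarrow> complex) \<Rightarrow> bool" where
  "phase_factorization n c l \<xi> \<longleftrightarrow>
     (\<forall>i<n. cmod (\<xi> i) = 1) \<and>
     (\<forall>i<n. \<forall>j<n. i \<noteq> j \<longrightarrow>
        c i j = - complex_of_real (cmod (c i j)) * (if j < i then 1 else l) * \<xi> i / \<xi> j)"

lemma phase_factorization_cong:
  "(\<And>i j. i < n \<Longrightarrow> j < n \<Longrightarrow> c i j = d i j) \<Longrightarrow>
    phase_factorization n c l \<xi> \<longleftrightarrow> phase_factorization n d l \<xi>"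
  by (simp add: phase_factorization_def)

text \<open>Off the diagonal a ray pattern is determined by its first column and
  \<open>cis \<psi>\<close>: condition (2) gives the rest of the lower part and condition (1) the
  upper part. Conversely, angles that are differences up to \<open>pi\<close> and
  \<open>\<psi>\<close> satisfy the congruences by telescoping.\<close>

lemma ray_pattern_class_iff_phase_factorization:
  assumes C: "C \<in> carrier_mat n n" and diag: "\<And>i. i < n \<Longrightarrow> C $$ (i, i) = 1" and n: "n > 0"
  shows "C \<in> ray_pattern_class n \<psi> \<longleftrightarrow>
    (\<exists>\<xi>. phase_factorization n (\<lambda>i j. C $$ (i, j)) (cis \<psi>) \<xi>)"
proof
  assume "C \<in> ray_pattern_class n \<psi>"
  then obtain \<eta> P where P: "ray_pattern_mat n \<psi> P"
    and CP: "\<And>r s. r < n \<Longrightarrow> s < n \<Longrightarrow> C $$ (r, s) = cis \<eta> * complex_of_real (cmod (C $$ (r, s))) * P $$ (r, s)"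
    by (auto simp: ray_pattern_class_def)
  from P[unfolded ray_pattern_mat_def] obtain \<theta> where \<theta>: "P = mat n n (\<lambda>(r, s). cis (\<theta> r s))"
    and c1: "\<forall>r<n. \<forall>s<n. r \<noteq> s \<longrightarrow> [\<theta> r s + \<theta> s r = \<psi>] (rmod (2 * pi))"
    and c2: "\<forall>r<n. \<forall>s<n. \<forall>t<n. (r < s \<and> s < t) \<or> (s < t \<and> t < r) \<or> (t < r \<and> r < s) \<longrightarrow>
        [\<theta> r s - \<theta> r t = \<theta> t s + pi] (rmod (2 * pi))"
    and c4: "\<forall>r<n. [\<theta> r r = 0] (rmod (2 * pi))"
    by (elim exE conjE) (rule that)
  define p where "p r s = cis (\<theta> r s)" for r s
  have p0: "p r s \<noteq> 0" for r s by (simp add: p_def)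
  have p1: "p r s = cis \<psi> / p s r" if "r < n" "s < n" "r \<noteq> s" for r s
  proof -
    have "cis (\<theta> r s + \<theta> s r) = cis \<psi>" unfolding cis_eq_iff using c1 that by blast
    then have "p r s * p s r = cis \<psi>" by (simp add: p_def cis_mult)
    then show ?thesis using p0[of s r] by (simp add: eq_divide_eq)
  qed
  have p2: "p t s = - p r s / p r t" if "r < n" "s < n" "t < n" "s < t" "t < r" for r s t
  proof -
    have "cis (\<theta> r s - \<theta> r t) = cis (\<theta> t s + pi)" unfolding cis_eq_iff using c2 that by blast
    then show ?thesis by (simp add: p_def cis_divide[symmetric] cis_mult[symmetric])
  qed
  have "cis (\<theta> 0 0) = cis 0" unfolding cis_eq_iff using c4 n by blast
  then have "p 0 0 = 1" by (simp add: p_def)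
  \<comment> \<open>Entry \<open>(0, 0)\<close> of both \<open>C\<close> and the pattern is 1, which
    removes the global rotation.\<close>
  then have "cis \<eta> = 1" using CP[OF n n] diag[OF n] n by (simp add: \<theta> p_def)
  then have Cp: "C $$ (r, s) = complex_of_real (cmod (C $$ (r, s))) * p r s" if "r < n" "s < n" for r s
    using CP[OF that] that by (simp add: \<theta> p_def)
  \<comment> \<open>Phases of column 0, normalised to 1 at index 0. The minus sign makes
    \<open>p r s = - \<xi> r / \<xi> s\<close> hold for \<open>s = 0\<close> as well.\<close>
  define \<xi> where "\<xi> r = (if r = 0 then 1 else - p r 0)" for r
  have lower: "p r s = - \<xi> r / \<xi> s" if "r < n" "s < r" for r s
  proof (cases "s = 0")
    case False
    then have "p s 0 = - p r 0 / p r s" using p2[of r 0 s] that by simp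
    then show ?thesis using p0[of s 0] p0[of r s] that False by (simp add: \<xi>_def field_simps)
  qed (use that in \<open>simp add: \<xi>_def\<close>)
  have "p r s = - (if s < r then 1 else cis \<psi>) * \<xi> r / \<xi> s" if "r < n" "s < n" "r \<noteq> s" for r s
  proof (cases "s < r")
    case False
    then have "p s r = - \<xi> s / \<xi> r" using lower that by simp
    then show ?thesis using p1[OF that] False by simp
  qed (use lower that in simp)
  then have "C $$ (r, s) = - complex_of_real (cmod (C $$ (r, s))) * (if s < r then 1 else cis \<psi>) * \<xi> r / \<xi> s"
    if "r < n" "s < n" "r \<noteq> s" for r s
    using Cp[of r s] that by (metis (no_types, lifting) minus_mult_commute mult.assoc times_divide_eq_right)
  moreover have "cmod (\<xi> r) = 1" for r by (simp add: \<xi>_def p_def)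
  ultimately show "\<exists>\<xi>. phase_factorization n (\<lambda>i j. C $$ (i, j)) (cis \<psi>) \<xi>"
    unfolding phase_factorization_def by (intro exI[of _ \<xi>]) simp
next
  assume "\<exists>\<xi>. phase_factorization n (\<lambda>i j. C $$ (i, j)) (cis \<psi>) \<xi>"
  then obtain \<xi> where \<xi>: "\<And>i. i < n \<Longrightarrow> cmod (\<xi> i) = 1"
    and eq: "\<And>r s. r < n \<Longrightarrow> s < n \<Longrightarrow> r \<noteq> s \<Longrightarrow>
      C $$ (r, s) = - complex_of_real (cmod (C $$ (r, s))) * (if s < r then 1 else cis \<psi>) * \<xi> r / \<xi> s"
    unfolding phase_factorization_def by blast
  define a where "a r = Arg (\<xi> r)" for r
  have cis_a: "cis (a r) = \<xi> r" if "r < n" for r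
  proof -
    have "\<xi> r \<noteq> 0" using \<xi>[OF that] by auto
    then show ?thesis using \<xi>[OF that] cis_Arg[of "\<xi> r"] by (simp add: a_def sgn_div_norm)
  qed
  \<comment> \<open>Off the diagonal this is an argument of the prescribed phase, with
    \<open>pi\<close> standing for its minus sign.\<close>
  define \<theta> where "\<theta> r s = (if r = s then 0 else pi + (if s < r then 0 else \<psi>) + a r - a s)" for r s
  define P where "P = mat n n (\<lambda>(r, s). cis (\<theta> r s))"
  \<comment> \<open>In each of the next three congruences the two sides differ by exactly one
    period, hence the witnesses -1 and 1.\<close>
  have t1: "[\<theta> r s + \<theta> s r = \<psi>] (rmod (2 * pi))" if "r \<noteq> s" for r s
    unfolding rcong_altdef using that by (intro exI[of _ "-1"]) (auto simp: \<theta>_def)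
  have t2: "[\<theta> r s - \<theta> r t = \<theta> t s + pi] (rmod (2 * pi))"
    if "(r < s \<and> s < t) \<or> (s < t \<and> t < r) \<or> (t < r \<and> r < s)" for r s t
    unfolding rcong_altdef using that by (intro exI[of _ 1]) (auto simp: \<theta>_def)
  have t3: "[\<theta> r s - \<theta> r t = \<theta> t s - \<psi> + pi] (rmod (2 * pi))"
    if "(r < t \<and> t < s) \<or> (t < s \<and> s < r) \<or> (s < r \<and> r < t)" for r s t
    unfolding rcong_altdef using that by (intro exI[of _ 1]) (auto simp: \<theta>_def)
  have t4: "[\<theta> r r = 0] (rmod (2 * pi))" for r by (simp add: \<theta>_def)
  have "ray_pattern_mat n \<psi> P"
    unfolding ray_pattern_mat_def P_def
    by (intro exI[of _ \<theta>] conjI allI impI refl t1 t2 t3 t4) assumption+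
  moreover have "C $$ (r, s) = cis 0 * complex_of_real (cmod (C $$ (r, s))) * P $$ (r, s)" if "r < n" "s < n" for r s
  proof (cases "r = s")
    case False
    then have "P $$ (r, s) = - (if s < r then 1 else cis \<psi>) * \<xi> r / \<xi> s"
      using that
      by (simp add: P_def \<theta>_def cis_a[symmetric] cis_mult[symmetric] cis_divide[symmetric])
    then show ?thesis using eq[OF that False]
      by (metis (no_types, lifting) cis_zero minus_mult_commute mult.assoc mult_1 times_divide_eq_right)
  qed (use that diag in \<open>simp add: P_def \<theta>_def\<close>)
  ultimately show "C \<in> ray_pattern_class n \<psi>"
    unfolding ray_pattern_class_def using C by blast
qed

section \<open>Phase factorizations versus FGS eigenvalues for a matrix with positive
  weights\<close>

context
  fixes n :: nat and A :: "complex mat" and u :: "nat \<Rightarrow> real"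
  assumes A: "A \<in> carrier_mat n n" and diag_nonzero: "\<forall>i<n. A $$ (i, i) \<noteq> 0"
    and n: "n > 0" and u: "\<forall>i<n. u i > 0"
    and weights: "\<forall>i<n.
      cmod (A $$ (i, i)) * u i = (\<Sum>j\<in>{..<n} - {i}. cmod (A $$ (i, j)) * u j)"
begin

text \<open>The eigenvector has entries \<open>u j * \<xi> j\<close>. In row \<open>i\<close> all
  nonzero off-diagonal terms point opposite to the diagonal term, and the weights balance the
  lengths.\<close>

lemma phase_factorization_imp_eigenvalue:
  assumes pf: "phase_factorization n (\<lambda>i j. A $$ (i, j) / A $$ (i, i)) l \<xi>"
  shows "eigenvalue (FGS_mat A) l"
proof -
  have \<xi>0: "\<xi> i \<noteq> 0" if "i < n" for i using pf that by (force simp: phase_factorization_def)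
  have "(\<Sum>j<n. (if j \<le> i then l else 1) * A $$ (i, j) * (u j * \<xi> j)) = 0" if i: "i < n" for i
  proof -
    have ne: "cmod (A $$ (i, i)) \<noteq> 0" using diag_nonzero[rule_format, OF i] by simp
    have summand: "(if j \<le> i then l else 1) * A $$ (i, j) * (u j * \<xi> j)
        = - (l * A $$ (i, i) * \<xi> i / cmod (A $$ (i, i))) * of_real (cmod (A $$ (i, j)) * u j)"
      if j: "j < n" "j \<noteq> i" for j
    proof -
      define w where "w = (if j \<le> i then l else 1)"
      define w' where "w' = (if j < i then 1 else l)"
      define q where "q = A $$ (i, j) / A $$ (i, i)"
      define c where "c = cmod q"
      have "A $$ (i, j) / A $$ (i, i)
          = - complex_of_real (cmod (A $$ (i, j) / A $$ (i, i))) * (if j < i then 1 else l) * \<xi> i / \<xi> j"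
        using pf i j unfolding phase_factorization_def by blast
      then have "q = - of_real c * w' * \<xi> i / \<xi> j" unfolding q_def c_def w'_def .
      then have q: "q * \<xi> j = - (of_real c * w' * \<xi> i)" using \<xi>0[OF j(1)] by simp
      have Aij: "A $$ (i, j) = A $$ (i, i) * q" using diag_nonzero[rule_format, OF i] by (simp add: q_def)
      \<comment> \<open>\<open>w\<close> from the eigenvalue equation and \<open>w'\<close> from the
        factorization put \<open>l\<close> on opposite sides of the diagonal.\<close>
      have ww: "w * w' = l" using j by (auto simp: w_def w'_def)
      have "w * A $$ (i, j) * (u j * \<xi> j) = A $$ (i, i) * w * u j * (q * \<xi> j)"
        unfolding Aij by (simp only: mult_ac)
      also have "\<dots> = - (A $$ (i, i) * (w * w') * u j * of_real c * \<xi> i)"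
        unfolding q by (simp only: mult_minus_right mult_ac)
      also have "\<dots> = - (l * A $$ (i, i) * \<xi> i / cmod (A $$ (i, i))) * of_real (cmod (A $$ (i, j)) * u j)"
        unfolding ww Aij norm_mult c_def[symmetric] using ne by simp
      finally show ?thesis unfolding w_def .
    qed
    have "(\<Sum>j<n. (if j \<le> i then l else 1) * A $$ (i, j) * (u j * \<xi> j))
        = l * A $$ (i, i) * (u i * \<xi> i)
          + (\<Sum>j\<in>{..<n} - {i}. (if j \<le> i then l else 1) * A $$ (i, j) * (u j * \<xi> j))"
      using i by (subst sum.remove[of _ i]) auto
    also have "(\<Sum>j\<in>{..<n} - {i}. (if j \<le> i then l else 1) * A $$ (i, j) * (u j * \<xi> j))
        = (\<Sum>j\<in>{..<n} - {i}. - (l * A $$ (i, i) * \<xi> i / cmod (A $$ (i, i)))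
            * of_real (cmod (A $$ (i, j)) * u j))"
      by (intro sum.cong summand) auto
    also have "\<dots> = - (l * A $$ (i, i) * \<xi> i / cmod (A $$ (i, i))) * of_real (cmod (A $$ (i, i)) * u i)"
      unfolding weights[rule_format, OF i] of_real_sum sum_distrib_left ..
    also have "\<dots> = - (l * A $$ (i, i) * (u i * \<xi> i))" using ne by simp
    finally show ?thesis by simp
  qed
  moreover have "u 0 * \<xi> 0 \<noteq> 0" using u[rule_format, OF n] \<xi>0[OF n] by simp
  ultimately show ?thesis
    unfolding FGS_eigenvalue_iff[OF A diag_nonzero]
    using n by (intro exI[of _ "\<lambda>j. of_real (u j) * \<xi> j"]) blast
qed

text \<open>A maximum principle: where \<open>y i / u i\<close> attains its maximum
  \<open>c\<close>, row \<open>i\<close> forces the same quotient at every \<open>j\<close> with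
  \<open>A $$ (i, j) \<noteq> 0\<close>, and irreducibility spreads it to all indices.\<close>

lemma subharmonic_proportional:
  assumes irr: "irreducible_mat n A"
    and y: "\<And>i. i < n \<Longrightarrow> cmod (A $$ (i, i)) * y i \<le> (\<Sum>j\<in>{..<n} - {i}. cmod (A $$ (i, j)) * y j)"
  obtains c where "\<And>i. i < n \<Longrightarrow> y i = c * u i"
proof -
  define c where "c = Max ((\<lambda>i. y i / u i) ` {..<n})"
  have le: "y i \<le> c * u i" if "i < n" for i
  proof -
    have "y i / u i \<le> c" unfolding c_def using that by (intro Max_ge) auto
    then show ?thesis using u[rule_format, OF that] by (simp add: pos_divide_le_eq)
  qed
  have "c \<in> (\<lambda>i. y i / u i) ` {..<n}" unfolding c_def using n by (intro Max_in) auto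
  then obtain k where "k < n" "c = y k / u k" by blast
  then have k: "k < n" "y k = c * u k" using u[rule_format, of k] by auto
  define S where "S = {i. i < n \<and> y i < c * u i}"
  have "S = {}"
  proof (rule ccontr)
    assume "S \<noteq> {}"
    moreover have "S \<subseteq> {..<n}" unfolding S_def by blast
    moreover have "k \<notin> S" using k by (simp add: S_def)
    then have "S \<noteq> {..<n}" using k(1) by blast
    \<comment> \<open>\<open>i\<close> attains the maximum and is linked to some \<open>j\<close>
      strictly below it, which makes the estimate in row \<open>i\<close> strict.\<close>
    ultimately obtain i j where ij: "i < n" "i \<notin> S" "j \<in> S" "A $$ (i, j) \<noteq> 0"
      using irreducible_mat_connected[OF irr, of S] by blast
    have yi: "y i = c * u i" using ij le[of i] by (simp add: S_def)
    have "(\<Sum>j\<in>{..<n} - {i}. cmod (A $$ (i, j)) * y j)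
        < (\<Sum>j\<in>{..<n} - {i}. cmod (A $$ (i, j)) * (c * u j))"
    proof (rule sum_strict_mono_ex1)
      have "cmod (A $$ (i, j)) * y j < cmod (A $$ (i, j)) * (c * u j)" "j \<in> {..<n} - {i}"
        using ij by (auto simp: S_def)
      then show "\<exists>j\<in>{..<n} - {i}. cmod (A $$ (i, j)) * y j < cmod (A $$ (i, j)) * (c * u j)"
        by blast
    qed (use le in \<open>auto intro: mult_left_mono\<close>)
    also have "\<dots> = c * (\<Sum>j\<in>{..<n} - {i}. cmod (A $$ (i, j)) * u j)"
      by (simp add: sum_distrib_left mult_ac)
    also have "\<dots> = cmod (A $$ (i, i)) * y i" unfolding weights[rule_format, OF ij(1), symmetric] yi by simp
    finally show False using y[OF ij(1)] by simp
  qed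
  then have "i \<notin> S" for i by simp
  then have "y i = c * u i" if "i < n" for i
    using le[OF that] that unfolding S_def by force
  with that show ?thesis by blast
qed

lemma eigenvalue_imp_phase_factorization:
  assumes irr: "irreducible_mat n A" and ev: "eigenvalue (FGS_mat A) l" and l: "cmod l \<ge> 1"
  shows "cmod l = 1" "\<exists>\<xi>. phase_factorization n (\<lambda>i j. A $$ (i, j) / A $$ (i, i)) l \<xi>"
proof -
  obtain x k where k: "k < n" "x k \<noteq> 0"
    and x: "\<And>i. i < n \<Longrightarrow> (\<Sum>j<n. (if j \<le> i then l else 1) * A $$ (i, j) * x j) = 0"
    using ev unfolding FGS_eigenvalue_iff[OF A diag_nonzero] by blast
  define w where "w i j = (if j < i then l else 1)" for i j :: nat
  define y where "y i = cmod (x i)" for i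
  have l0: "l \<noteq> 0" using l by auto
  have w: "cmod (w i j) \<le> cmod l" for i j using l by (simp add: w_def)
  have off: "l * A $$ (i, i) * x i = - (\<Sum>j\<in>{..<n} - {i}. w i j * A $$ (i, j) * x j)"
    if i: "i < n" for i
  proof -
    have "0 = l * A $$ (i, i) * x i
        + (\<Sum>j\<in>{..<n} - {i}. (if j \<le> i then l else 1) * A $$ (i, j) * x j)"
      unfolding x[OF i, symmetric] using i by (subst sum.remove[of _ i]) auto
    also have "(\<Sum>j\<in>{..<n} - {i}. (if j \<le> i then l else 1) * A $$ (i, j) * x j)
        = (\<Sum>j\<in>{..<n} - {i}. w i j * A $$ (i, j) * x j)"
      by (intro sum.cong) (auto simp: w_def)
    finally show ?thesis by (simp add: eq_neg_iff_add_eq_0)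
  qed
  \<comment> \<open>The factors \<open>cmod (w i j)\<close> are kept here instead of being bounded
    by \<open>cmod l\<close>, because row 0 later needs their exact value 1.\<close>
  have norm_off: "cmod l * (cmod (A $$ (i, i)) * y i)
      \<le> (\<Sum>j\<in>{..<n} - {i}. cmod (w i j) * (cmod (A $$ (i, j)) * y j))" if i: "i < n" for i
  proof -
    have "cmod l * (cmod (A $$ (i, i)) * y i) = cmod (l * A $$ (i, i) * x i)"
      by (simp add: norm_mult y_def)
    also have "\<dots> \<le> (\<Sum>j\<in>{..<n} - {i}. cmod (w i j * A $$ (i, j) * x j))"
      unfolding off[OF i] norm_minus_cancel by (rule norm_sum)
    finally show ?thesis by (simp add: norm_mult y_def mult.assoc)
  qed
  have sub: "cmod (A $$ (i, i)) * y i \<le> (\<Sum>j\<in>{..<n} - {i}. cmod (A $$ (i, j)) * y j)"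
    if i: "i < n" for i
  proof -
    note norm_off[OF i]
    also have "(\<Sum>j\<in>{..<n} - {i}. cmod (w i j) * (cmod (A $$ (i, j)) * y j))
        \<le> (\<Sum>j\<in>{..<n} - {i}. cmod l * (cmod (A $$ (i, j)) * y j))"
      using w by (intro sum_mono mult_right_mono) (auto simp: y_def)
    finally show ?thesis
      using l0 unfolding sum_distrib_left[symmetric] by simp
  qed
  obtain c where c: "\<And>i. i < n \<Longrightarrow> y i = c * u i"
    using subharmonic_proportional[OF irr sub] by blast
  have "c > 0" using c[OF k(1)] k(2) u[rule_format, OF k(1)] by (metis y_def zero_less_norm_iff zero_less_mult_pos2)
  then have ypos: "y i > 0" if "i < n" for i using c u that by simp
  have harm: "cmod (A $$ (i, i)) * y i = (\<Sum>j\<in>{..<n} - {i}. cmod (A $$ (i, j)) * y j)"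
    if i: "i < n" for i
  proof -
    have "(\<Sum>j\<in>{..<n} - {i}. cmod (A $$ (i, j)) * y j) = (\<Sum>j\<in>{..<n} - {i}. c * (cmod (A $$ (i, j)) * u j))"
      by (intro sum.cong) (auto simp: c)
    also have "\<dots> = c * (cmod (A $$ (i, i)) * u i)"
      unfolding weights[rule_format, OF i] sum_distrib_left ..
    finally show ?thesis by (simp add: c[OF i])
  qed
  \<comment> \<open>All off-diagonal entries of the first row lie in the upper part, so \<open>l\<close> multiplies none of them.\<close>
  have "cmod l * (cmod (A $$ (0, 0)) * y 0) \<le> 1 * (cmod (A $$ (0, 0)) * y 0)"
    using norm_off[OF n] unfolding harm[OF n] by (simp add: w_def)
  moreover have "cmod (A $$ (0, 0)) * y 0 > 0" using ypos[OF n] diag_nonzero[rule_format, OF n] by simp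
  ultimately have "cmod l \<le> 1" by (metis mult_le_cancel_right_pos)
  with l show l1: "cmod l = 1" by simp
  define \<xi> where "\<xi> i = x i / y i" for i
  have "A $$ (i, j) / A $$ (i, i)
      = - complex_of_real (cmod (A $$ (i, j) / A $$ (i, i))) * (if j < i then 1 else l) * \<xi> i / \<xi> j"
    if ij: "i < n" "j < n" "i \<noteq> j" for i j
  proof -
    \<comment> \<open>Row \<open>i\<close> solved for \<open>x i\<close>: the off-diagonal
      \<open>f j\<close> add up to \<open>x i\<close> and their moduli to
      \<open>y i = cmod (x i)\<close>, which is the equality case of the triangle
      inequality.\<close>
    define f where "f j = - (w i j / l) * (A $$ (i, j) / A $$ (i, i)) * x j" for j
    have Aii: "A $$ (i, i) \<noteq> 0" using diag_nonzero ij by simp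
    have w1: "cmod (w i j) = 1" for j using l1 by (simp add: w_def)
    have "(\<Sum>j\<in>{..<n} - {i}. f j) = - (\<Sum>j\<in>{..<n} - {i}. w i j * A $$ (i, j) * x j) / (l * A $$ (i, i))"
      by (simp add: f_def sum_divide_distrib sum_negf)
    then have sum_f: "sum f ({..<n} - {i}) = x i"
      unfolding off[OF ij(1), symmetric] using l0 Aii by simp
    have norm_f: "cmod (f j) = cmod (A $$ (i, j)) * y j / cmod (A $$ (i, i))" for j
      by (simp add: f_def norm_mult norm_divide l1 w1 y_def)
    have "(\<Sum>j\<in>{..<n} - {i}. cmod (f j)) = y i"
      unfolding norm_f sum_divide_distrib[symmetric] harm[OF ij(1), symmetric] using Aii by simp
    then have "f j * y i = cmod (f j) * x i"
      using norm_sum_eq_sum_norm_aligned[of "{..<n} - {i}" f j] ij sum_f by (simp add: y_def)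
    then have *: "- (w i j / l) * (A $$ (i, j) / A $$ (i, i)) * x j * y i
        = cmod (A $$ (i, j) / A $$ (i, i)) * y j * x i"
      unfolding norm_f by (simp add: f_def norm_divide)
    have yj: "y j \<noteq> 0" "y i \<noteq> 0" and xj: "x j \<noteq> 0"
      using ypos[OF ij(1)] ypos[OF ij(2)] by (auto simp: y_def)
    have w0: "w i j \<noteq> 0" using w1[of j] by auto
    \<comment> \<open>Multiplying and dividing by the nonzero factors brings in the alignment
      identity and isolates the entry.\<close>
    have "A $$ (i, j) / A $$ (i, i)
        = (- (w i j / l) * (A $$ (i, j) / A $$ (i, i)) * x j * y i) / (- (w i j / l) * x j * y i)"
      using w0 l0 xj yj by simp
    also have "\<dots> = - complex_of_real (cmod (A $$ (i, j) / A $$ (i, i))) * (l / w i j) * \<xi> i / \<xi> j"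
      unfolding * using w0 l0 xj yj by (simp add: \<xi>_def mult_ac)
    also have "l / w i j = (if j < i then 1 else l)" using l0 by (simp add: w_def)
    finally show ?thesis .
  qed
  moreover have "cmod (\<xi> i) = 1" if "i < n" for i
    using ypos[OF that] by (simp add: \<xi>_def norm_divide y_def)
  ultimately show "\<exists>\<xi>. phase_factorization n (\<lambda>i j. A $$ (i, j) / A $$ (i, i)) l \<xi>"
    unfolding phase_factorization_def by blast
qed

end

theorem theorem4p13:
  fixes n :: nat and A :: "complex mat"
  assumes "n \<ge> 3"
    and "A \<in> carrier_mat n n"
    and "irreducible_mat n A"
    and "A \<in> mixed_H_matrices n"
  shows "(spectral_radius (FGS_mat A) < 1 \<longleftrightarrow>
            (\<forall>\<psi>::real. inv_mat (diag_part A) * A \<notin> ray_pattern_class n \<psi>)) \<and>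
         (\<forall>b \<in> carrier_vec n. spectral_radius (FGS_mat A) < 1 \<longleftrightarrow> FGS_converges n A b)"
proof -
  have n: "n > 0" using assms by simp
  note A = \<open>A \<in> carrier_mat n n\<close>
  have nz: "\<forall>i<n. A $$ (i, i) \<noteq> 0"
    using assms(4) by (simp add: mixed_H_matrices_def)
  obtain u where u: "\<forall>i<n. u i > 0"
    "\<forall>i<n. cmod (A $$ (i, i)) * u i = (\<Sum>j\<in>{..<n} - {i}. cmod (A $$ (i, j)) * u j)"
    using mixed_H_matrix_weights[OF assms(4,3) n] by blast
  let ?C = "inv_mat (diag_part A) * A"
  let ?pf = "\<lambda>l. \<exists>\<xi>. phase_factorization n (\<lambda>i j. A $$ (i, j) / A $$ (i, i)) l \<xi>"
  have C: "?C $$ (i, j) = A $$ (i, j) / A $$ (i, i)" if "i < n" "j < n" for i j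
    using inv_mat_diag_part_mult_index[OF A _ that] nz by blast
  have D: "diag_part A \<in> carrier_mat n n" using A by (simp add: diag_part_def)
  have "det (diag_part A) \<noteq> 0"
    using A nz by (intro lower_triangular_det_nonzero[OF D]) (auto simp: diag_part_def)
  then have Cc: "?C \<in> carrier_mat n n" using inv_mat_det_nonzero(1)[OF D] A by simp
  have ray: "?C \<in> ray_pattern_class n \<psi> \<longleftrightarrow> ?pf (cis \<psi>)" for \<psi>
    using ray_pattern_class_iff_phase_factorization[OF Cc _ n, of \<psi>] C nz
      phase_factorization_cong[of n "\<lambda>i j. ?C $$ (i, j)" "\<lambda>i j. A $$ (i, j) / A $$ (i, i)"]
    by simp
  have H: "FGS_mat A \<in> carrier_mat n n" using FGS_mat_carrier[OF A nz] .
  have "spectral_radius (FGS_mat A) < 1 \<longleftrightarrow> (\<forall>\<psi>. \<not> ?pf (cis \<psi>))"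
  proof
    assume sr: "spectral_radius (FGS_mat A) < 1"
    show "\<forall>\<psi>. \<not> ?pf (cis \<psi>)"
    proof (intro allI notI)
      fix \<psi> assume "?pf (cis \<psi>)"
      then have "eigenvalue (FGS_mat A) (cis \<psi>)"
        using phase_factorization_imp_eigenvalue[OF A nz n u] by blast
      from cmod_eigenvalue_le_spectral_radius[OF H this] show False using sr by simp
    qed
  next
    assume none: "\<forall>\<psi>. \<not> ?pf (cis \<psi>)"
    show "spectral_radius (FGS_mat A) < 1"
    proof (rule ccontr)
      assume ge: "\<not> ?thesis"
      obtain l where l: "eigenvalue (FGS_mat A) l" "cmod l = spectral_radius (FGS_mat A)"
        using spectral_radius_eigenvalueE[OF H n] .
      then have "cmod l \<ge> 1" using ge by simp
      from eigenvalue_imp_phase_factorization[OF A nz n u assms(3) l(1) this]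
      have "cmod l = 1" "?pf l" .
      \<comment> \<open>Modulus 1 lets \<open>Arg l\<close> serve as the \<open>\<psi>\<close> of
        the ray pattern class.\<close>
      then have "cis (Arg l) = l"
        by (metis cis_Arg div_by_1 norm_zero of_real_1 sgn_eq zero_neq_one)
      then have "?pf (cis (Arg l))" using \<open>?pf l\<close> by simp
      with none show False by blast
    qed
  qed
  then show ?thesis using ray FGS_converges_iff[OF A nz n] by simp
qed

end
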